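(* Let $G=(V,E)$ be a directed graph with propagation probabilities $p:V\times V\to[0,1]$ and let $A\subseteq V$. Then the set function $S\mapsto \sigma(A,S)$, defined on subsets $S\subseteq (A\times V)\setminus E$, is monotonically increasing (i.e. $\sigma(A,S)\le\sigma(A,T)$ whenever $S\subseteq T$) and submodular, i.e. for all $S\subseteq T\subseteq (A\times V)\setminus E$ and every $e\in (A\times V)\setminus (E\cup T)$, $$\sigma(A,S\cup\{e\})-\sigma(A,S)\ \ge\ \sigma(A,T\cup\{e\})-\sigma(A,T).$$
   Context: Independent Cascade Model (ICM): given a seed set $A\subseteq V$, the nodes of $A$ are active at the start; in discrete steps, each node $u$ that has just become active gets exactly one chance to activate each currently inactive out-neighbour $v$, succeeding independently with probability $p_{(u,v)}$; the process stops when no new node becomes active. Equivalently, each edge $e$ is declared "live" independently with probability $p_e$, and the final active set is the set of nodes reachable from $A$ by paths of live edges. For $S\subseteq (V\times V)\setminus E$, let $G(S)=(V,E\cup S)$ (new edges carry the probabilities given by $p$), and let $\sigma(A,S)$ be the expected number of active nodes at the end of the ICM process on $G(S)$ with seed set $A$. *)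

theory Defs
  imports "HOL-Probability.Probability"
begin

definition attempts :: "('a \<times> 'a) set \<Rightarrow> 'a set \<times> 'a set \<Rightarrow> ('a \<times> 'a) set" where
  "attempts E = (\<lambda>(Act, New). {(u, v) \<in> E. u \<in> New \<and> v \<notin> Act})"

(* A state is (Act, New): the active nodes, and those among them that became active in the
   latest step.  All attempts of one step are made simultaneously, each with its own coin;
   v becomes active iff at least one attempt on v succeeds.  Once New is empty, the state
   does not change any more. *)
definition icm_step ::
    "('a \<times> 'a) set \<Rightarrow> ('a \<times> 'a \<Rightarrow> real) \<Rightarrow> 'a set \<times> 'a set \<Rightarrow> ('a set \<times> 'a set) pmf" where
  "icm_step E p = (\<lambda>(Act, New).
     map_pmf (\<lambda>success. let New' = {v. \<exists>u. (u, v) \<in> attempts E (Act, New) \<and> success (u, v)}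
                        in (Act \<union> New', New'))
       (Pi_pmf (attempts E (Act, New)) False (\<lambda>e. bernoulli_pmf (p e))))"

primrec icm ::
    "('a \<times> 'a) set \<Rightarrow> ('a \<times> 'a \<Rightarrow> real) \<Rightarrow> 'a set \<Rightarrow> nat \<Rightarrow> ('a set \<times> 'a set) pmf" where
  "icm E p A 0 = return_pmf (A, A)"
| "icm E p A (Suc n) = bind_pmf (icm E p A n) (icm_step E p)"

(* On a finite graph (V, E) the process has always stopped after card V steps: see the
   lemma icm_stopped below. *)
definition icm_final ::
    "'a set \<Rightarrow> ('a \<times> 'a) set \<Rightarrow> ('a \<times> 'a \<Rightarrow> real) \<Rightarrow> 'a set \<Rightarrow> 'a set pmf" where
  "icm_final V E p A = map_pmf fst (icm E p A (card V))"

definition exp_active ::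
    "'a set \<Rightarrow> ('a \<times> 'a) set \<Rightarrow> ('a \<times> 'a \<Rightarrow> real) \<Rightarrow> 'a set \<Rightarrow> ('a \<times> 'a) set \<Rightarrow> real" where
  "exp_active V E p A S =
     measure_pmf.expectation (icm_final V (E \<union> S) p A) (\<lambda>Act. real (card Act))"

lemma icm_invariant:
  assumes "finite V" "E \<subseteq> V \<times> V" "A \<subseteq> V" "(Act, New) \<in> set_pmf (icm E p A n)"
  shows "Act \<subseteq> V \<and> New \<subseteq> Act \<and> (New \<noteq> {} \<longrightarrow> n < card Act)"
  using assms(4)
proof (induction n arbitrary: Act New)
  case 0
  then show ?case
    using assms by (auto simp: card_gt_0_iff dest: finite_subset)
next
  case (Suc n)
  then obtain Act0 New0 s where st: "(Act0, New0) \<in> set_pmf (icm E p A n)"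
    and New: "New = {v. \<exists>u. (u, v) \<in> attempts E (Act0, New0) \<and> s (u, v)}"
    and Act: "Act = Act0 \<union> New"
    by (auto simp: icm_step_def Let_def)
  note IH = Suc.IH[OF st]
  have sub: "New \<subseteq> V" "New \<inter> Act0 = {}"
    using assms(2) by (auto simp: New attempts_def)
  have "Suc n < card Act" if "New \<noteq> {}"
  proof -
    have "New0 \<noteq> {}" using that by (auto simp: New attempts_def)
    then have "n < card Act0" using IH by simp
    moreover have "finite Act" using Act IH sub assms(1) by (auto intro: finite_subset)
    then have "card Act0 < card Act"
      using that sub Act by (intro psubset_card_mono) auto
    ultimately show ?thesis by simp
  qed
  then show ?case using Act IH sub by auto
qed

lemma icm_stopped:
  assumes "finite V" "E \<subseteq> V \<times> V" "A \<subseteq> V" "(Act, New) \<in> set_pmf (icm E p A (card V))"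
  shows "New = {}"
  using icm_invariant[OF assms] card_mono[OF assms(1), of Act] by fastforce

end

theory Submission
  imports Defs
begin

text \<open>
  Deferring the coin flips shows that the process can be run by flipping all coins first: every
  edge is tried at most once, since its tail is newly active only once. Hence the final active set
  is distributed like the set of nodes reachable from \<open>A\<close> in a random live graph, and the live
  graphs for all \<open>S\<close> can be coupled by one family of coins on \<open>V \<times> V\<close>. For fixed coins, a new edge
  out of \<open>A\<close> only adds its head as a further seed, so the number of reachable nodes is a coverage
  function of the set of new edges; taking expectations preserves monotonicity and submodularity.
\<close>

section \<open>Deferred coins: the process as a deterministic cascade\<close>

text \<open>The deterministic counterpart of \<open>icm_step\<close> for a fixed set
  \<open>L\<close> of live edges: breadth-first search with frontier \<open>New\<close>. The state
  pair is kept so that iterates can be matched with the states of \<open>icm\<close>.\<close>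

definition cascade :: "('a \<times> 'a) set \<Rightarrow> 'a set \<times> 'a set \<Rightarrow> 'a set \<times> 'a set" where
  "cascade L = (\<lambda>(Act, New). (Act \<union> (L `` New - Act), L `` New - Act))"

lemma icm_step_eq_cascade:
  "icm_step E p s =
     map_pmf (\<lambda>\<omega>. cascade {e \<in> E. \<omega> e} s) (Pi_pmf (attempts E s) False (\<lambda>e. bernoulli_pmf (p e)))"
  unfolding icm_step_def cascade_def
  by (cases s) (auto simp: Let_def attempts_def intro!: map_pmf_cong)

text \<open>Nodes in \<open>Act - New\<close> have spent their chance and never return to the
  frontier, so edges out of them are not read in any round and \<open>L\<close>, \<open>L'\<close>
  may differ there.\<close>

lemma cascade_funpow_cong:
  assumes "New \<subseteq> Act" and "\<And>u v. u \<notin> Act - New \<Longrightarrow> (u, v) \<in> L \<longleftrightarrow> (u, v) \<in> L'"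
  shows "(cascade L ^^ n) (Act, New) = (cascade L' ^^ n) (Act, New)"
  using assms
proof (induction n arbitrary: Act New)
  case (Suc n)
  define N where "N = L `` New - Act"
  have "L' `` New - Act = N"
    using Suc.prems unfolding N_def by blast
  then have "cascade L (Act, New) = (Act \<union> N, N)" "cascade L' (Act, New) = (Act \<union> N, N)"
    by (auto simp: cascade_def N_def)
  \<comment> \<open>Since \<open>N\<close> avoids \<open>Act\<close>, the spent nodes are now all of
    \<open>Act\<close>, which contains \<open>Act - New\<close>; the agreement required of
    \<open>L\<close> and \<open>L'\<close> only gets weaker.\<close>
  moreover have "(cascade L ^^ n) (Act \<union> N, N) = (cascade L' ^^ n) (Act \<union> N, N)"
    using Suc.prems by (intro Suc.IH) (auto simp: N_def)
  ultimately show ?case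
    by (simp add: funpow_Suc_right del: funpow.simps)
qed simp

text \<open>
  The coins used by the first step can be reflipped afterwards, because no later step reads them.
\<close>
lemma icm_step_bind_cascade:
  fixes p :: "'a \<times> 'a \<Rightarrow> real"
  defines "coins \<equiv> \<lambda>F. Pi_pmf F False (\<lambda>e. bernoulli_pmf (p e))"
  assumes "finite E" and "New \<subseteq> Act"
  shows "bind_pmf (icm_step E p (Act, New))
           (\<lambda>s. map_pmf (\<lambda>\<omega>. (cascade {e \<in> E. \<omega> e} ^^ m) s) (coins E))
         = map_pmf (\<lambda>\<omega>. (cascade {e \<in> E. \<omega> e} ^^ Suc m) (Act, New)) (coins E)"
proof -
  define D where "D = attempts E (Act, New)"
  \<comment> \<open>\<open>f\<close> supplies the coins read in the current step, \<open>g\<close>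
    all others.\<close>
  define merge where
    "merge = (\<lambda>f g e. if e \<in> D then f e else g e :: bool)"
  have D: "D \<subseteq> E" "finite D" "finite (E - D)"
    using \<open>finite E\<close> by (auto simp: D_def attempts_def intro: finite_subset)
  have DE: "D \<union> (E - D) = E"
    using D by auto
  let ?N = "\<lambda>f. {e \<in> E. f e} `` New - Act"
  let ?s = "\<lambda>f. (Act \<union> ?N f, ?N f)"
  have first: "cascade {e \<in> E. merge f g e} (Act, New) = ?s f" for f g
    unfolding cascade_def merge_def D_def attempts_def by auto
  \<comment> \<open>Every edge of \<open>D\<close> starts in \<open>New\<close>, and
    \<open>New\<close> is already spent in the state \<open>?s f\<close>; from there on the coins on
    \<open>D\<close> do not matter.\<close>
  have later: "(cascade {e \<in> E. merge f g e} ^^ m) (?s f) = (cascade {e \<in> E. g e} ^^ m) (?s f)"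
    for f g
    by (rule cascade_funpow_cong) (use \<open>New \<subseteq> Act\<close> in \<open>auto simp: merge_def D_def attempts_def\<close>)
  have later': "(cascade {e \<in> E. if e \<in> E - D then g e else False} ^^ m) (?s f)
      = (cascade {e \<in> E. g e} ^^ m) (?s f)" for f g
    by (rule cascade_funpow_cong) (use \<open>New \<subseteq> Act\<close> in \<open>auto simp: D_def attempts_def\<close>)
  have rest: "coins (E - D) = map_pmf (\<lambda>g e. if e \<in> E - D then g e else False) (coins E)"
    unfolding coins_def using \<open>finite E\<close> by (intro Pi_pmf_subset) auto
  have split: "coins E = map_pmf (\<lambda>(f, g). merge f g) (pair_pmf (coins D) (coins (E - D)))"
    using Pi_pmf_union[OF D(2,3), of False "\<lambda>e. bernoulli_pmf (p e)"]
    unfolding DE coins_def merge_def by blast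
  have "map_pmf (\<lambda>\<omega>. (cascade {e \<in> E. \<omega> e} ^^ Suc m) (Act, New)) (coins E)
      = map_pmf (\<lambda>(f, g). (cascade {e \<in> E. g e} ^^ m) (?s f)) (pair_pmf (coins D) (coins (E - D)))"
    unfolding split by (simp add: funpow_Suc_right first later pmf.map_comp comp_def case_prod_unfold
        del: funpow.simps Un_Diff_cancel)
  also have "\<dots> = bind_pmf (coins D)
      (\<lambda>f. map_pmf (\<lambda>g. (cascade {e \<in> E. g e} ^^ m) (?s f)) (coins (E - D)))"
    by (simp add: pair_pmf_def map_bind_pmf map_pmf_def bind_assoc_pmf bind_return_pmf)
  \<comment> \<open>Here the coins on \<open>D\<close> are flipped afresh:
    \<open>coins (E - D)\<close> is the law of \<open>coins E\<close> with \<open>D\<close> reset to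
    \<open>False\<close>, and by \<open>later'\<close> the reset does not affect the run from
    \<open>?s f\<close>.\<close>
  also have "\<dots> = bind_pmf (coins D)
      (\<lambda>f. map_pmf (\<lambda>g. (cascade {e \<in> E. g e} ^^ m) (?s f)) (coins E))"
    unfolding rest by (simp only: pmf.map_comp comp_def later')
  also have "\<dots> = bind_pmf (icm_step E p (Act, New))
      (\<lambda>s. map_pmf (\<lambda>\<omega>. (cascade {e \<in> E. \<omega> e} ^^ m) s) (coins E))"
    by (simp add: icm_step_eq_cascade bind_map_pmf D_def coins_def cascade_def)
  finally show ?thesis by simp
qed

lemma icm_eq_map_cascade:
  fixes p :: "'a \<times> 'a \<Rightarrow> real"
  assumes "finite V" "E \<subseteq> V \<times> V" "A \<subseteq> V"
  shows "icm E p A n = map_pmf (\<lambda>\<omega>. (cascade {e \<in> E. \<omega> e} ^^ n) (A, A))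
           (Pi_pmf E False (\<lambda>e. bernoulli_pmf (p e)))"
proof -
  let ?C = "Pi_pmf E False (\<lambda>e. bernoulli_pmf (p e))"
  have "finite E"
    using assms by (auto intro: finite_subset)
  \<comment> \<open>The claim interpolates: \<open>n\<close> steps of the process, then
    \<open>m\<close> rounds with coins flipped in advance. The induction trades the last process
    step for one more round, so \<open>m\<close> must vary; \<open>m = 0\<close> gives the
    goal.\<close>
  have "bind_pmf (icm E p A n) (\<lambda>s. map_pmf (\<lambda>\<omega>. (cascade {e \<in> E. \<omega> e} ^^ m) s) ?C)
      = map_pmf (\<lambda>\<omega>. (cascade {e \<in> E. \<omega> e} ^^ (n + m)) (A, A)) ?C" for m
  proof (induction n arbitrary: m)
    case 0
    then show ?case by (simp add: bind_return_pmf)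
  next
    case (Suc n)
    have "bind_pmf (icm E p A (Suc n)) (\<lambda>s. map_pmf (\<lambda>\<omega>. (cascade {e \<in> E. \<omega> e} ^^ m) s) ?C)
        = bind_pmf (icm E p A n) (\<lambda>s. map_pmf (\<lambda>\<omega>. (cascade {e \<in> E. \<omega> e} ^^ Suc m) s) ?C)"
      unfolding icm.simps bind_assoc_pmf
    proof (rule bind_pmf_cong[OF refl])
      fix s assume s: "s \<in> set_pmf (icm E p A n)"
      obtain Act New where [simp]: "s = (Act, New)"
        by fastforce
      have "New \<subseteq> Act"
        using icm_invariant[OF assms] s by auto
      from icm_step_bind_cascade[OF \<open>finite E\<close> this]
      show "bind_pmf (icm_step E p s) (\<lambda>s. map_pmf (\<lambda>\<omega>. (cascade {e \<in> E. \<omega> e} ^^ m) s) ?C)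
          = map_pmf (\<lambda>\<omega>. (cascade {e \<in> E. \<omega> e} ^^ Suc m) s) ?C"
        by simp
    qed
    then show ?case
      using Suc.IH[of "Suc m"] by simp
  qed
  from this[of 0] show ?thesis
    by (simp add: bind_return_pmf')
qed

section \<open>The final active set as reachability along live edges\<close>

text \<open>Only the frontier still has unexplored out-edges. Once \<open>New\<close> is empty, the
  last conjunct makes \<open>Act\<close> closed under \<open>L\<close>, so \<open>Act\<close> is
  exactly the set reachable from \<open>A\<close>.\<close>

lemma cascade_funpow_invariant:
  assumes "(cascade L ^^ n) (A, A) = (Act, New)"
  shows "A \<subseteq> Act \<and> New \<subseteq> Act \<and> Act \<subseteq> L\<^sup>* `` A \<and> L `` (Act - New) \<subseteq> Act"
  using assms
proof (induction n arbitrary: Act New)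
  case (Suc n)
  obtain Act0 New0 where s: "(cascade L ^^ n) (A, A) = (Act0, New0)"
    by fastforce
  note IH = Suc.IH[OF s]
  have New: "New = L `` New0 - Act0" and Act: "Act = Act0 \<union> New"
    using Suc.prems s by (auto simp: cascade_def)
  have "L `` New0 \<subseteq> L\<^sup>* `` A"
  proof
    fix v assume "v \<in> L `` New0"
    then obtain u where "u \<in> L\<^sup>* `` A" "(u, v) \<in> L"
      using IH by blast
    then show "v \<in> L\<^sup>* `` A"
      by (blast intro: rtrancl.rtrancl_into_rtrancl)
  qed
  then show ?case
    using IH unfolding New Act by blast
qed auto

lemma icm_final_eq_reachable:
  fixes p :: "'a \<times> 'a \<Rightarrow> real"
  assumes "finite V" "E \<subseteq> V \<times> V" "A \<subseteq> V"
  shows "icm_final V E p A = map_pmf (\<lambda>\<omega>. {e \<in> E. \<omega> e}\<^sup>* `` A)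
           (Pi_pmf E False (\<lambda>e. bernoulli_pmf (p e)))"
  unfolding icm_final_def icm_eq_map_cascade[OF assms] pmf.map_comp
proof (rule map_pmf_cong[OF refl])
  fix \<omega> assume \<omega>: "\<omega> \<in> set_pmf (Pi_pmf E False (\<lambda>e. bernoulli_pmf (p e)))"
  let ?L = "{e \<in> E. \<omega> e}"
  obtain Act New where s: "(cascade ?L ^^ card V) (A, A) = (Act, New)"
    by fastforce
  \<comment> \<open>Termination is known for the random process; it transfers to the run with coins
    \<open>\<omega>\<close> because the end state of that run lies in the support of
    \<open>icm\<close>.\<close>
  have "(Act, New) \<in> set_pmf (icm E p A (card V))"
    unfolding icm_eq_map_cascade[OF assms] set_map_pmf using \<omega> s by force
  then have "New = {}"
    by (rule icm_stopped[OF assms])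
  then have inv: "A \<subseteq> Act" "Act \<subseteq> ?L\<^sup>* `` A" "?L `` Act \<subseteq> Act"
    using cascade_funpow_invariant[OF s] by auto
  then have "?L\<^sup>* `` A \<subseteq> Act"
    using Image_closed_trancl[OF inv(3)] by blast
  then show "(fst \<circ> (\<lambda>\<omega>. (cascade {e \<in> E. \<omega> e} ^^ card V) (A, A))) \<omega> = ?L\<^sup>* `` A"
    using s inv by auto
qed

text \<open>This is the coupling: the coin space on \<open>V \<times> V\<close> does not depend on
  \<open>S\<close>, so different \<open>S\<close> can be compared coin by coin.\<close>

lemma exp_active_eq_expectation_reachable:
  fixes p :: "'a \<times> 'a \<Rightarrow> real"
  assumes "finite V" "E \<union> S \<subseteq> V \<times> V" "A \<subseteq> V"
  shows "exp_active V E p A S =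
    measure_pmf.expectation (Pi_pmf (V \<times> V) False (\<lambda>e. bernoulli_pmf (p e)))
      (\<lambda>\<omega>. real (card ({e \<in> E \<union> S. \<omega> e}\<^sup>* `` A)))"
proof -
  have "Pi_pmf (E \<union> S) False (\<lambda>e. bernoulli_pmf (p e)) =
      map_pmf (\<lambda>\<omega> e. if e \<in> E \<union> S then \<omega> e else False)
        (Pi_pmf (V \<times> V) False (\<lambda>e. bernoulli_pmf (p e)))"
    using assms by (intro Pi_pmf_subset) auto
  moreover have "{e \<in> E \<union> S. if e \<in> E \<union> S then \<omega> e else False} = {e \<in> E \<union> S. \<omega> e}" for \<omega>
    by auto
  ultimately show ?thesis
    unfolding exp_active_def icm_final_eq_reachable[OF assms]
    by (simp only: integral_map_pmf)
qed

section \<open>Reachability after adding edges out of the seed set\<close>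

text \<open>The tail of an edge in \<open>S\<close> is a seed and thus always reached, so the edge
  has the same effect as seeding its head.\<close>

lemma reachable_Un_out_edges:
  assumes "S \<subseteq> A \<times> UNIV"
  shows "(L \<union> S)\<^sup>* `` A = L\<^sup>* `` (A \<union> snd ` S)"
proof
  have "(L \<union> S) `` (L\<^sup>* `` (A \<union> snd ` S)) \<subseteq> L\<^sup>* `` (A \<union> snd ` S)"
  proof
    fix v assume "v \<in> (L \<union> S) `` (L\<^sup>* `` (A \<union> snd ` S))"
    then obtain u where u: "u \<in> L\<^sup>* `` (A \<union> snd ` S)" "(u, v) \<in> L \<union> S"
      by blast
    show "v \<in> L\<^sup>* `` (A \<union> snd ` S)"
    proof (cases "(u, v) \<in> S")
      case True
      then have "v \<in> snd ` S" by force
      then show ?thesis by blast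
    next
      case False
      then show ?thesis
        using u by (blast intro: rtrancl.rtrancl_into_rtrancl)
    qed
  qed
  from Image_closed_trancl[OF this] show "(L \<union> S)\<^sup>* `` A \<subseteq> L\<^sup>* `` (A \<union> snd ` S)"
    by blast
next
  have "S `` A \<subseteq> (L \<union> S)\<^sup>* `` A" and "snd ` S \<subseteq> S `` A"
    using assms by (blast, force)
  then have *: "A \<union> snd ` S \<subseteq> (L \<union> S)\<^sup>* `` A"
    by blast
  show "L\<^sup>* `` (A \<union> snd ` S) \<subseteq> (L \<union> S)\<^sup>* `` A"
  proof
    fix v assume "v \<in> L\<^sup>* `` (A \<union> snd ` S)"
    then obtain u where "u \<in> A \<union> snd ` S" "(u, v) \<in> L\<^sup>*"
      by blast
    moreover from this(2) have "(u, v) \<in> (L \<union> S)\<^sup>*"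
      using rtrancl_mono[of L "L \<union> S"] by blast
    ultimately show "v \<in> (L \<union> S)\<^sup>* `` A"
      using * by (blast intro: rtrancl_trans)
  qed
qed

text \<open>Reachability distributes over unions of seed sets, so adding \<open>e\<close> to
  \<open>X\<close> gains exactly the nodes of \<open>H - R X\<close>, and this set shrinks as
  \<open>X\<close> grows. Finiteness lets \<open>card\<close> turn the disjoint union into a
  sum.\<close>

lemma card_reachable_submodular:
  assumes fin: "finite (L\<^sup>* `` (insert (snd e) (A \<union> snd ` T)))"
    and "S \<subseteq> T" "T \<subseteq> A \<times> UNIV" "e \<in> A \<times> UNIV"
  shows "real (card ((L \<union> insert e S)\<^sup>* `` A)) - real (card ((L \<union> S)\<^sup>* `` A))
       \<ge> real (card ((L \<union> insert e T)\<^sup>* `` A)) - real (card ((L \<union> T)\<^sup>* `` A))"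
proof -
  define H where "H = L\<^sup>* `` {snd e}"
  define R where "R = (\<lambda>S. (L \<union> S)\<^sup>* `` A)"
  have R: "R X = L\<^sup>* `` (A \<union> snd ` X)" "R (insert e X) = R X \<union> (H - R X)" if "X \<subseteq> T" for X
  proof -
    have "X \<subseteq> A \<times> UNIV" "insert e X \<subseteq> A \<times> UNIV"
      using that assms by auto
    note this[THEN reachable_Un_out_edges[where L = L]]
    then show "R X = L\<^sup>* `` (A \<union> snd ` X)" "R (insert e X) = R X \<union> (H - R X)"
      unfolding R_def H_def by auto
  qed
  have fin': "finite (R T)" "finite H"
    by (rule finite_subset[OF _ fin]; use R(1)[of T] in \<open>auto simp: H_def\<close>)+
  have sub: "R S \<subseteq> R T"
    unfolding R(1)[OF assms(2)] R(1)[OF subset_refl]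
    using assms(2) by (intro Image_mono Un_mono image_mono) auto
  have diff: "real (card (R (insert e X))) - real (card (R X)) = real (card (H - R X))"
    if "X \<subseteq> T" "finite (R X)" for X
    using that fin' R(2)[OF that(1)] by (simp only:) (subst card_Un_disjoint; auto)
  have "card (H - R T) \<le> card (H - R S)"
    using sub fin' by (intro card_mono) auto
  then show ?thesis
    using diff[of S] diff[of T] assms(2) fin' finite_subset[OF sub] unfolding R_def by simp
qed

section \<open>From fixed coins to expectations\<close>

theorem theorem4:
  fixes V :: "'a set" and E :: "('a \<times> 'a) set"
    and p :: "'a \<times> 'a \<Rightarrow> real" and A :: "'a set"
  assumes "finite V" and "E \<subseteq> V \<times> V"
    and "\<forall>e \<in> V \<times> V. 0 \<le> p e \<and> p e \<le> 1"
    and "A \<subseteq> V"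
  shows "(\<forall>S T. S \<subseteq> T \<and> T \<subseteq> (A \<times> V) - E \<longrightarrow> exp_active V E p A S \<le> exp_active V E p A T) \<and>
         (\<forall>S T e. S \<subseteq> T \<and> T \<subseteq> (A \<times> V) - E \<and> e \<in> (A \<times> V) - (E \<union> T) \<longrightarrow>
            exp_active V E p A (S \<union> {e}) - exp_active V E p A S
              \<ge> exp_active V E p A (T \<union> {e}) - exp_active V E p A T)"
proof -
  define M where "M = Pi_pmf (V \<times> V) False (\<lambda>e. bernoulli_pmf (p e))"
  define R where "R = (\<lambda>S \<omega>. {e \<in> E \<union> S. \<omega> e}\<^sup>* `` A)"
  \<comment> \<open>Finite support makes every real function integrable, which settles all
    integrability conditions below.\<close>
  have "finite (set_pmf M)"
    unfolding M_def using \<open>finite V\<close>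
    by (simp add: set_Pi_pmf finite_PiE_dflt)
  then have int: "integrable (measure_pmf M) f" for f :: "_ \<Rightarrow> real"
    by (rule integrable_measure_pmf_finite)
  have exp: "exp_active V E p A S = measure_pmf.expectation M (\<lambda>\<omega>. real (card (R S \<omega>)))"
    if "S \<subseteq> A \<times> V" for S
    unfolding M_def R_def
    by (rule exp_active_eq_expectation_reachable) (use assms that in auto)
  have reach_V: "L\<^sup>* `` B \<subseteq> V" if "L \<subseteq> V \<times> V" "B \<subseteq> V" for L B
    using Image_closed_trancl[of L V] that by blast
  show ?thesis
  proof (intro conjI allI impI; elim conjE)
    fix S T assume ST: "S \<subseteq> T" "T \<subseteq> A \<times> V - E"
    have "card (R S \<omega>) \<le> card (R T \<omega>)" for \<omega>
    proof (rule card_mono)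
      have "R T \<omega> \<subseteq> V"
        unfolding R_def using assms ST by (intro reach_V) auto
      then show "finite (R T \<omega>)"
        using \<open>finite V\<close> finite_subset by blast
      have "{e \<in> E \<union> S. \<omega> e} \<subseteq> {e \<in> E \<union> T. \<omega> e}"
        using ST by auto
      from rtrancl_mono[OF this] show "R S \<omega> \<subseteq> R T \<omega>"
        unfolding R_def by blast
    qed
    moreover have "S \<subseteq> A \<times> V" "T \<subseteq> A \<times> V"
      using ST by auto
    ultimately show "exp_active V E p A S \<le> exp_active V E p A T"
      by (auto simp: exp int intro!: integral_mono)
  next
    fix S T e assume ST: "S \<subseteq> T" "T \<subseteq> A \<times> V - E" "e \<in> A \<times> V - (E \<union> T)"
    have pointwise: "real (card (R (T \<union> {e}) \<omega>)) - real (card (R T \<omega>))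
        \<le> real (card (R (S \<union> {e}) \<omega>)) - real (card (R S \<omega>))" for \<omega>
    \<comment> \<open>A dead \<open>e\<close> changes neither live graph, so both gains are 0; only
      a live \<open>e\<close> needs the coverage argument.\<close>
    proof (cases "\<omega> e")
      case True
      let ?live = "\<lambda>F. {e \<in> F. \<omega> e}"
      have live: "?live (E \<union> X) = ?live E \<union> ?live X"
        "?live (E \<union> (X \<union> {e})) = ?live E \<union> insert e (?live X)" for X
        using True by auto
      have "(?live E)\<^sup>* `` (insert (snd e) (A \<union> snd ` ?live T)) \<subseteq> V"
        using assms ST by (intro reach_V) auto
      then have "finite ((?live E)\<^sup>* `` (insert (snd e) (A \<union> snd ` ?live T)))"
        using \<open>finite V\<close> finite_subset by blast
      \<comment> \<open>\<open>live(2)\<close> is rewritten first, since \<open>live(1)\<close>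
        would also match the sets containing \<open>e\<close> and hide the \<open>insert e\<close>
        form.\<close>
      then show ?thesis
        unfolding R_def live(2) unfolding live(1) by (rule card_reachable_submodular) (use ST in auto)
    next
      case False
      then have "{e' \<in> E \<union> (X \<union> {e}). \<omega> e'} = {e' \<in> E \<union> X. \<omega> e'}" for X
        by auto
      then show ?thesis
        unfolding R_def by simp
    qed
    have sub: "S \<subseteq> A \<times> V" "T \<subseteq> A \<times> V" "S \<union> {e} \<subseteq> A \<times> V" "T \<union> {e} \<subseteq> A \<times> V"
      using ST by auto
    have "measure_pmf.expectation M (\<lambda>\<omega>. real (card (R (T \<union> {e}) \<omega>)) - real (card (R T \<omega>)))
        \<le> measure_pmf.expectation M (\<lambda>\<omega>. real (card (R (S \<union> {e}) \<omega>)) - real (card (R S \<omega>)))"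
      by (intro integral_mono int pointwise)
    then show "exp_active V E p A (T \<union> {e}) - exp_active V E p A T
        \<le> exp_active V E p A (S \<union> {e}) - exp_active V E p A S"
      unfolding sub[THEN exp] by (simp only: Bochner_Integration.integral_diff[OF int int])
  qed
qed

end
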